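(* Let $\Phi$ and $\Psi$ be Orlicz functions and let $w=(w_m)_{m\in\mathbb{Z}}$ be a sequence of weights with $w_m>0$ for every $m\in\mathbb{Z}$. Then the following statements hold. (a) If there exists $\gamma\in(0,1]$ such that $\Phi(t)\le\Psi(\gamma t)$ for every $t\in[0,+\infty)$, and if $k,k'\in\mathbb{R}$ satisfy $k'\ge k\ge 0$, then there exist the continuous embeddings $$l_{k',\Psi,w}\rightarrow l_{k,\Phi,w}\qquad\text{and}\qquad \mathsf{s}_{k',\Psi,w}\rightarrow\mathsf{s}_{k,\Phi,w}.$$ (b) If there exist $\gamma\in(0,+\infty)$ and $t_0\in(0,+\infty)$ such that $\Phi(t)\le\Psi(\gamma t)$ for every $t\in[0,t_0]$, if $k\ge 0$, and if $\inf_{m\in\mathbb{Z}}w_m>0$, then there exist the continuous embeddings $$l_{k,\Psi,w}\rightarrow l_{\Phi,w}\qquad\text{and}\qquad \mathsf{s}_{k,\Psi,w}\rightarrow\mathsf{s}_{\Phi,w}.$$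
   Context: An Orlicz function is a continuous, non-decreasing, convex function $\Phi:[0,+\infty)\to[0,+\infty)$ with $\Phi(0)=0$, $\Phi(t)>0$ for every $t>0$ and $\lim_{t\to+\infty}\Phi(t)=+\infty$. Given an Orlicz function $\Phi$, positive weights $w=(w_m)_{m\in\mathbb{Z}}$ and $k\in\mathbb{R}$, put, for a complex sequence $\mathsf{p}=(p_m)_{m\in\mathbb{Z}}$, $$\|\mathsf{p}\|_{k,\Phi,w}:=\inf\Big\{\rho>0:\ \sum_{m\in\mathbb{Z}}w_m(1+\Phi(|m|))^k\,\Phi\Big(\frac{|p_m|}{\rho}\Big)\le 1\Big\}$$ (with $\inf\emptyset=+\infty$). The space $l_{k,\Phi,w}$ is the set of all complex sequences with $\|\mathsf{p}\|_{k,\Phi,w}<+\infty$, and $\mathsf{s}_{k,\Phi,w}$ is its vector subspace consisting of all complex sequences $\mathsf{p}$ such that $\sum_{m\in\mathbb{Z}}w_m(1+\Phi(|m|))^k\,\Phi(|p_m|/\rho)<+\infty$ for every $\rho>0$. Both are Banach spaces under the norm $\|\cdot\|_{k,\Phi,w}$. For $k=0$ one writes $l_{\Phi,w}$ and $\mathsf{s}_{\Phi,w}$ for $l_{0,\Phi,w}$ and $\mathsf{s}_{0,\Phi,w}$. The same definitions apply with $\Psi$ in place of $\Phi$ (with $\Psi$ also replacing $\Phi$ in the factor $(1+\Phi(|m|))^k$). A continuous embedding $X\to Y$ between two of these spaces means that $X\subseteq Y$ as sets of sequences and that the inclusion map is a bounded linear operator from $X$ to $Y$. *)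

theory Defs
  imports "HOL-Analysis.Analysis"
begin

text \<open>
  Functions on \<open>[0,\<infinity>)\<close> are represented by total functions on the reals; every notion below uses
  their values at nonnegative arguments only.
\<close>

definition orlicz :: "(real \<Rightarrow> real) \<Rightarrow> bool" where
  "orlicz \<Phi> \<longleftrightarrow>
     \<Phi> \<in> {0..} \<rightarrow> {0..} \<and> continuous_on {0..} \<Phi> \<and> mono_on {0..} \<Phi> \<and> convex_on {0..} \<Phi> \<and>
     \<Phi> 0 = 0 \<and> (\<forall>t>0. \<Phi> t > 0) \<and> filterlim \<Phi> at_top at_top"

text \<open>
  The sum of nonnegative terms is taken in \<open>[0,\<infinity>]\<close>, so that divergence means that its value
  is \<open>top\<close>.  The terms are nonnegative for positive weights, so \<^const>\<open>ennreal\<close> truncates nothing.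
\<close>

definition orlicz_modular ::
    "real \<Rightarrow> (real \<Rightarrow> real) \<Rightarrow> (int \<Rightarrow> real) \<Rightarrow> real \<Rightarrow> (int \<Rightarrow> complex) \<Rightarrow> ennreal" where
  "orlicz_modular k \<Phi> w \<rho> p =
     (\<Sum>\<^sub>\<infinity>m\<in>UNIV. ennreal (w m * (1 + \<Phi> (real_of_int \<bar>m\<bar>)) powr k * \<Phi> (cmod (p m) / \<rho>)))"

text \<open>The infimum is taken in \<open>[0,\<infinity>]\<close>, where \<^prop>\<open>Inf {} = (top :: ennreal)\<close>.\<close>

definition orlicz_norm ::
    "real \<Rightarrow> (real \<Rightarrow> real) \<Rightarrow> (int \<Rightarrow> real) \<Rightarrow> (int \<Rightarrow> complex) \<Rightarrow> ennreal" where
  "orlicz_norm k \<Phi> w p = Inf {ennreal \<rho> | \<rho>. \<rho> > 0 \<and> orlicz_modular k \<Phi> w \<rho> p \<le> 1}"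

definition orlicz_l ::
    "real \<Rightarrow> (real \<Rightarrow> real) \<Rightarrow> (int \<Rightarrow> real) \<Rightarrow> (int \<Rightarrow> complex) set" where
  "orlicz_l k \<Phi> w = {p. orlicz_norm k \<Phi> w p < top}"

definition orlicz_s ::
    "real \<Rightarrow> (real \<Rightarrow> real) \<Rightarrow> (int \<Rightarrow> real) \<Rightarrow> (int \<Rightarrow> complex) set" where
  "orlicz_s k \<Phi> w = {p. \<forall>\<rho>>0. orlicz_modular k \<Phi> w \<rho> p < top}"

text \<open>
  Spaces of sequences are sets \<open>X\<close>, \<open>Y\<close> of type \<^typ>\<open>(int \<Rightarrow> complex) set\<close>, with norms \<open>NX\<close>, \<open>NY\<close>
  that may be infinite off the space; hence the library's type-based \<^const>\<open>bounded_linear\<close>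
  does not apply.
\<close>

definition bounded_linear_between ::
    "(int \<Rightarrow> complex) set \<Rightarrow> ((int \<Rightarrow> complex) \<Rightarrow> ennreal) \<Rightarrow>
     (int \<Rightarrow> complex) set \<Rightarrow> ((int \<Rightarrow> complex) \<Rightarrow> ennreal) \<Rightarrow>
     ((int \<Rightarrow> complex) \<Rightarrow> (int \<Rightarrow> complex)) \<Rightarrow> bool" where
  "bounded_linear_between X NX Y NY T \<longleftrightarrow>
     T \<in> X \<rightarrow> Y \<and>
     (\<forall>p\<in>X. \<forall>q\<in>X. T (\<lambda>m. p m + q m) = (\<lambda>m. T p m + T q m)) \<and>
     (\<forall>c. \<forall>p\<in>X. T (\<lambda>m. c * p m) = (\<lambda>m. c * T p m)) \<and>
     (\<exists>C::real. C \<ge> 0 \<and> (\<forall>p\<in>X. NY (T p) \<le> ennreal C * NX p))"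

definition continuous_embedding ::
    "(int \<Rightarrow> complex) set \<Rightarrow> ((int \<Rightarrow> complex) \<Rightarrow> ennreal) \<Rightarrow>
     (int \<Rightarrow> complex) set \<Rightarrow> ((int \<Rightarrow> complex) \<Rightarrow> ennreal) \<Rightarrow> bool" where
  "continuous_embedding X NX Y NY \<longleftrightarrow> X \<subseteq> Y \<and> bounded_linear_between X NX Y NY (\<lambda>p. p)"

lemma orlicz_s_subset_l:
  assumes \<Phi>: "orlicz \<Phi>" and w: "\<And>m. w m > 0"
  shows "orlicz_s k \<Phi> w \<subseteq> orlicz_l k \<Phi> w"
proof
  fix p assume p: "p \<in> orlicz_s k \<Phi> w"
  define g where "g m = w m * (1 + \<Phi> (real_of_int \<bar>m\<bar>)) powr k" for m
  have g: "g m \<ge> 0" for m using w[of m] by (simp add: g_def)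
  have nonneg: "\<Phi> t \<ge> 0" if "t \<ge> 0" for t using \<Phi> that by (auto simp: orlicz_def)
  define M where "M = orlicz_modular k \<Phi> w 1 p"
  have "M < top" using p by (simp add: orlicz_s_def M_def)
  then obtain r where r: "r \<ge> 0" "M = ennreal r" by (cases M) auto
  define N where "N = max 1 r"
  have N: "N \<ge> 1" "N \<ge> r" by (auto simp: N_def)
  have scale: "\<Phi> (t / N) \<le> \<Phi> t / N" if "t \<ge> 0" for t
  proof -
    have "convex_on {0..} \<Phi>" "\<Phi> 0 = 0" using \<Phi> by (auto simp: orlicz_def)
    then show ?thesis
      using convex_onD[of "{0..}" \<Phi> "1/N" 0 t] that N by simp
  qed
  have "orlicz_modular k \<Phi> w N p \<le> 1"
    unfolding orlicz_modular_def
  proof (subst nonneg_infsum_complete, simp, rule SUP_least, clarify)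
    fix F :: "int set" assume F: "finite F"
    have "(\<Sum>m\<in>F. ennreal (g m * \<Phi> (cmod (p m)))) \<le> M"
      unfolding M_def orlicz_modular_def g_def
      by (subst nonneg_infsum_complete) (auto intro!: SUP_upper F)
    then have *: "(\<Sum>m\<in>F. g m * \<Phi> (cmod (p m))) \<le> N"
      using r N g nonneg by (simp add: sum_nonneg)
    have "(\<Sum>m\<in>F. g m * \<Phi> (cmod (p m) / N)) \<le> (\<Sum>m\<in>F. g m * (\<Phi> (cmod (p m)) / N))"
      using g scale by (intro sum_mono mult_left_mono) auto
    also have "\<dots> = (\<Sum>m\<in>F. g m * \<Phi> (cmod (p m))) / N" by (simp add: sum_divide_distrib)
    also have "\<dots> \<le> 1" using * N by simp
    finally show "(\<Sum>m\<in>F. ennreal (w m * (1 + \<Phi> (real_of_int \<bar>m\<bar>)) powr k * \<Phi> (cmod (p m) / N))) \<le> 1"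
      using g nonneg N unfolding g_def[symmetric] by simp
  qed
  then have "orlicz_norm k \<Phi> w p \<le> ennreal N"
    unfolding orlicz_norm_def using N by (intro Inf_lower) auto
  then show "p \<in> orlicz_l k \<Phi> w"
    by (simp add: orlicz_l_def le_less_trans[OF _ ennreal_less_top])
qed

end

theory Submission
  imports Defs
begin

text \<open>
  In (a) the modular of the target space is dominated termwise by that of the source space.
  In (b) the lower bound on the weights turns a bound on the source modular into a uniform bound
  on the quotients \<open>\<bar>p\<^sub>m\<bar>/\<rho>\<close>.  Rescaling \<open>\<rho>\<close> by a constant moves them into \<open>[0, t\<^sub>0]\<close>, where
  the comparison of \<open>\<Phi>\<close> with \<open>\<Psi>\<close> holds; this bounds the norm.  For the spaces \<open>s\<close> no rescaling is
  allowed, but on a bounded interval \<open>[0, T]\<close> the comparison still holds up to a constant factor,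
  since \<open>\<Psi>\<close> is bounded away from zero on \<open>[\<gamma> t\<^sub>0, \<infinity>)\<close>.
\<close>

section \<open>Growth and comparison of Orlicz functions\<close>

lemma orlicz_nonneg: "orlicz \<Phi> \<Longrightarrow> t \<ge> 0 \<Longrightarrow> \<Phi> t \<ge> 0"
  by (auto simp: orlicz_def)

lemma orlicz_mono: "orlicz \<Phi> \<Longrightarrow> 0 \<le> s \<Longrightarrow> s \<le> t \<Longrightarrow> \<Phi> s \<le> \<Phi> t"
  by (auto simp: orlicz_def mono_on_def)

lemma orlicz_ex_gt:
  assumes "orlicz \<Phi>"
  shows "\<exists>T>0. B < \<Phi> T"
proof -
  have "eventually (\<lambda>t. B < \<Phi> t) at_top"
    using assms by (simp add: orlicz_def filterlim_at_top_dense)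
  then obtain N where "\<And>t. t \<ge> N \<Longrightarrow> B < \<Phi> t"
    by (auto simp: eventually_at_top_linorder)
  then show ?thesis
    by (intro exI[of _ "max 1 N"]) auto
qed

lemma orlicz_less_imp_less:
  assumes "orlicz \<Phi>" "0 \<le> T" "\<Phi> s < \<Phi> T"
  shows "s < T"
  using orlicz_mono[OF assms(1,2), of s] assms(3) by (meson leD leI)

lemma orlicz_comparison_extend:
  assumes \<Phi>: "orlicz \<Phi>" and \<Psi>: "orlicz \<Psi>" and \<gamma>: "\<gamma> > 0" and t\<^sub>0: "t\<^sub>0 > 0"
    and le: "\<forall>t\<in>{0..t\<^sub>0}. \<Phi> t \<le> \<Psi> (\<gamma> * t)"
  shows "\<exists>K\<ge>1. \<forall>t\<in>{0..T}. \<Phi> t \<le> K * \<Psi> (\<gamma> * t)"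
proof -
  \<comment> \<open>The quotient serves \<open>t\<close> in \<open>(t\<^sub>0, T]\<close>, where
    \<open>\<Phi> t\<close> is at most \<open>\<Phi> T\<close> and
    \<open>\<Psi> (\<gamma> * t)\<close> is at least \<open>\<Psi> (\<gamma> * t\<^sub>0)\<close>.
    The lower bound 1 serves \<open>[0, t\<^sub>0]\<close>.\<close>
  define K where "K = max 1 (\<Phi> T / \<Psi> (\<gamma> * t\<^sub>0))"
  have pos: "\<Psi> (\<gamma> * t\<^sub>0) > 0"
    using \<Psi> \<gamma> t\<^sub>0 by (simp add: orlicz_def)
  have K: "K \<ge> 1" by (simp add: K_def)
  have "\<Phi> t \<le> K * \<Psi> (\<gamma> * t)" if t: "t \<in> {0..T}" for t
  proof (cases "t \<le> t\<^sub>0")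
    case True
    then have "\<Phi> t \<le> 1 * \<Psi> (\<gamma> * t)" using le t by simp
    also have "\<dots> \<le> K * \<Psi> (\<gamma> * t)"
      using K orlicz_nonneg[OF \<Psi>] \<gamma> t by (intro mult_right_mono) auto
    finally show ?thesis .
  next
    case False
    have "\<Phi> t \<le> \<Phi> T" using orlicz_mono[OF \<Phi>] t by simp
    also have "\<dots> = \<Phi> T / \<Psi> (\<gamma> * t\<^sub>0) * \<Psi> (\<gamma> * t\<^sub>0)" using pos by simp
    also have "\<dots> \<le> K * \<Psi> (\<gamma> * t)"
      using pos K False \<gamma> t\<^sub>0 by (intro mult_mono orlicz_mono[OF \<Psi>]) (auto simp: K_def)
    finally show ?thesis .
  qed
  with K show ?thesis by blast
qed

section \<open>Comparison of modulars and of norms\<close>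

lemma orlicz_modular_term_le:
  "ennreal (w m * (1 + \<Phi> (real_of_int \<bar>m\<bar>)) powr k * \<Phi> (cmod (p m) / \<rho>))
     \<le> orlicz_modular k \<Phi> w \<rho> p"
  unfolding orlicz_modular_def
  by (subst nonneg_infsum_complete) (auto intro!: SUP_upper2[of "{m}"])

text \<open>Both modulars carry the same weights, so \<open>le\<close> leaves them out. The scales
  \<open>\<rho>\<close> and \<open>\<sigma>\<close> are independent and \<open>K\<close> is
  arbitrary, so that the lemma covers the rescaled comparisons and those with a constant
  factor.\<close>

lemma orlicz_modular_mono:
  assumes K: "K \<ge> 0" and w: "\<And>m. w m > 0"
    and le: "\<And>m. (1 + \<Phi> (real_of_int \<bar>m\<bar>)) powr k * \<Phi> (cmod (p m) / \<rho>)
                   \<le> K * ((1 + \<Psi> (real_of_int \<bar>m\<bar>)) powr k' * \<Psi> (cmod (p m) / \<sigma>))"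
  shows "orlicz_modular k \<Phi> w \<rho> p \<le> ennreal K * orlicz_modular k' \<Psi> w \<sigma> p"
proof -
  define f where "f m = w m * (1 + \<Phi> (real_of_int \<bar>m\<bar>)) powr k * \<Phi> (cmod (p m) / \<rho>)" for m
  define g where "g m = w m * (1 + \<Psi> (real_of_int \<bar>m\<bar>)) powr k' * \<Psi> (cmod (p m) / \<sigma>)" for m
  have "f m \<le> K * g m" for m
    using mult_left_mono[OF le[of m], of "w m"] w[of m] by (simp add: f_def g_def mult_ac)
  then have fg: "ennreal (f m) \<le> ennreal K * ennreal (g m)" for m
    using K by (metis ennreal_leI ennreal_mult')
  \<comment> \<open>An infinite sum in [0, \<infinity>] is the supremum of its finite partial sums,
    so a bound uniform in \<open>F\<close> suffices.\<close>
  have "(\<Sum>m\<in>F. ennreal (f m)) \<le> ennreal K * (\<Sum>\<^sub>\<infinity>m. ennreal (g m))" if "finite F" for F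
  proof -
    have "(\<Sum>m\<in>F. ennreal (f m)) \<le> ennreal K * (\<Sum>m\<in>F. ennreal (g m))"
      unfolding sum_distrib_left by (intro sum_mono fg)
    also have "\<dots> \<le> ennreal K * (\<Sum>\<^sub>\<infinity>m. ennreal (g m))"
      using that by (subst nonneg_infsum_complete) (auto intro!: mult_left_mono SUP_upper)
    finally show ?thesis .
  qed
  then show ?thesis
    unfolding orlicz_modular_def f_def[symmetric] g_def[symmetric]
    by (subst nonneg_infsum_complete) (auto intro!: SUP_least)
qed

text \<open>Each \<open>\<rho>\<close> admissible in the infimum on the right yields
  \<open>C * \<rho>\<close> admissible in the one on the left. An infinite norm on the right is
  covered as well, since \<open>C\<close> is positive.\<close>

lemma orlicz_norm_le_mult:
  assumes C: "C > 0"
    and le: "\<And>\<rho>. \<rho> > 0 \<Longrightarrow> orlicz_modular k' \<Psi> w \<rho> p \<le> 1 \<Longrightarrow> orlicz_modular k \<Phi> w (C * \<rho>) p \<le> 1"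
  shows "orlicz_norm k \<Phi> w p \<le> ennreal C * orlicz_norm k' \<Psi> w p"
proof -
  \<comment> \<open>With \<open>C\<close> moved to the left, the right-hand side is a bare infimum,
    and it suffices to bound each of its elements from below.\<close>
  have "orlicz_norm k \<Phi> w p / ennreal C \<le> orlicz_norm k' \<Psi> w p"
    unfolding orlicz_norm_def[of k']
  proof (rule Inf_greatest, clarify)
    fix \<rho> :: real assume \<rho>: "\<rho> > 0" "orlicz_modular k' \<Psi> w \<rho> p \<le> 1"
    have "orlicz_norm k \<Phi> w p \<le> ennreal (C * \<rho>)"
      unfolding orlicz_norm_def using le[OF \<rho>] C \<rho> by (intro Inf_lower) auto
    then show "orlicz_norm k \<Phi> w p / ennreal C \<le> ennreal \<rho>"
      using C \<rho> by (intro divide_le_posI_ennreal) (auto simp: ennreal_mult)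
  qed
  then have "ennreal C * (orlicz_norm k \<Phi> w p / ennreal C) \<le> ennreal C * orlicz_norm k' \<Psi> w p"
    by (rule mult_left_mono) simp
  then show ?thesis
    using C by (simp add: ennreal_times_divide mult_divide_eq_ennreal mult.commute[of "ennreal C" "orlicz_norm k \<Phi> w p"])
qed

section \<open>Continuous embeddings\<close>

lemma continuous_embeddingI:
  assumes "X \<subseteq> Y" and "C \<ge> 0" and "\<And>p. p \<in> X \<Longrightarrow> NY p \<le> ennreal C * NX p"
  shows "continuous_embedding X NX Y NY"
  using assms by (auto simp: continuous_embedding_def bounded_linear_between_def)

text \<open>The spaces \<open>l\<close> and \<open>s\<close> carry the same norm, so one norm
  inequality bounds both inclusion maps. It also gives the inclusion of the spaces \<open>l\<close>,
  which are defined by finiteness of the norm. Membership in \<open>s\<close> concerns the modular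
  at every scale, hence the separate assumption \<open>fin\<close>.\<close>

lemma orlicz_embeddings:
  assumes C: "C > 0"
    and norm: "\<And>p \<rho>. \<rho> > 0 \<Longrightarrow> orlicz_modular k' \<Psi> w \<rho> p \<le> 1
                  \<Longrightarrow> orlicz_modular k \<Phi> w (C * \<rho>) p \<le> 1"
    and fin: "orlicz_s k' \<Psi> w \<subseteq> orlicz_s k \<Phi> w"
  shows "continuous_embedding (orlicz_l k' \<Psi> w) (orlicz_norm k' \<Psi> w)
           (orlicz_l k \<Phi> w) (orlicz_norm k \<Phi> w) \<and>
         continuous_embedding (orlicz_s k' \<Psi> w) (orlicz_norm k' \<Psi> w)
           (orlicz_s k \<Phi> w) (orlicz_norm k \<Phi> w)"
proof -
  have le: "orlicz_norm k \<Phi> w p \<le> ennreal C * orlicz_norm k' \<Psi> w p" for p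
    using C norm by (rule orlicz_norm_le_mult)
  have "orlicz_l k' \<Psi> w \<subseteq> orlicz_l k \<Phi> w"
    using le by (auto simp: orlicz_l_def intro!: le_less_trans[OF le] ennreal_mult_less_top[THEN iffD2])
  with fin le C show ?thesis
    by (intro conjI continuous_embeddingI[where C = C]) auto
qed

text \<open>As \<open>\<gamma>\<close> is at most 1 and \<open>\<Psi>\<close> is monotone,
  \<open>\<Phi>\<close> lies below \<open>\<Psi>\<close> everywhere. The modulars then compare at
  the same \<open>\<rho>\<close>, and the embedding constant is 1.\<close>

lemma orlicz_embedding_global:
  assumes \<Phi>: "orlicz \<Phi>" and \<Psi>: "orlicz \<Psi>" and w: "\<And>m. w m > 0"
    and \<gamma>: "0 < \<gamma>" "\<gamma> \<le> 1" and le: "\<forall>t\<ge>0. \<Phi> t \<le> \<Psi> (\<gamma> * t)"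
    and k: "k \<le> k'" "0 \<le> k"
  shows "continuous_embedding (orlicz_l k' \<Psi> w) (orlicz_norm k' \<Psi> w)
           (orlicz_l k \<Phi> w) (orlicz_norm k \<Phi> w) \<and>
         continuous_embedding (orlicz_s k' \<Psi> w) (orlicz_norm k' \<Psi> w)
           (orlicz_s k \<Phi> w) (orlicz_norm k \<Phi> w)"
proof -
  have \<Phi>\<Psi>: "\<Phi> t \<le> \<Psi> t" if "t \<ge> 0" for t
    using le that \<gamma> orlicz_mono[OF \<Psi>, of "\<gamma> * t" t]
    by (force simp: mult_left_le_one_le)
  have mod: "orlicz_modular k \<Phi> w \<rho> p \<le> orlicz_modular k' \<Psi> w \<rho> p" if \<rho>: "\<rho> > 0" for p \<rho>
  proof -
    \<comment> \<open>First the base grows, which uses \<open>k \<ge> 0\<close>; then the exponent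
      grows, which uses that the base is at least 1.\<close>
    have pw: "(1 + \<Phi> (real_of_int \<bar>m\<bar>)) powr k \<le> (1 + \<Psi> (real_of_int \<bar>m\<bar>)) powr k'" for m
    proof -
      have "(1 + \<Phi> (real_of_int \<bar>m\<bar>)) powr k \<le> (1 + \<Psi> (real_of_int \<bar>m\<bar>)) powr k"
        using k \<Phi>\<Psi> orlicz_nonneg[OF \<Phi>] by (intro powr_mono2) (auto simp: add_nonneg_nonneg)
      also have "\<dots> \<le> (1 + \<Psi> (real_of_int \<bar>m\<bar>)) powr k'"
        using k orlicz_nonneg[OF \<Psi>] by (intro powr_mono) auto
      finally show ?thesis .
    qed
    have "orlicz_modular k \<Phi> w \<rho> p \<le> ennreal 1 * orlicz_modular k' \<Psi> w \<rho> p"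
    proof (rule orlicz_modular_mono[OF _ w])
      fix m
      show "(1 + \<Phi> (real_of_int \<bar>m\<bar>)) powr k * \<Phi> (cmod (p m) / \<rho>)
              \<le> 1 * ((1 + \<Psi> (real_of_int \<bar>m\<bar>)) powr k' * \<Psi> (cmod (p m) / \<rho>))"
        unfolding mult_1 using \<rho> orlicz_nonneg[OF \<Phi>] by (intro mult_mono pw \<Phi>\<Psi>) auto
    qed simp
    then show ?thesis by simp
  qed
  show ?thesis
  proof (rule orlicz_embeddings[where C = 1])
    show "orlicz_s k' \<Psi> w \<subseteq> orlicz_s k \<Phi> w"
      using mod by (auto simp: orlicz_s_def intro: le_less_trans)
  qed (auto intro: order_trans[OF mod])
qed

lemma orlicz_embedding_local:
  assumes \<Phi>: "orlicz \<Phi>" and \<Psi>: "orlicz \<Psi>" and w: "\<And>m. w m > 0"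
    and \<gamma>: "\<gamma> > 0" and t\<^sub>0: "t\<^sub>0 > 0" and le: "\<forall>t\<in>{0..t\<^sub>0}. \<Phi> t \<le> \<Psi> (\<gamma> * t)"
    and k: "k \<ge> 0" and c: "c > 0" "\<And>m. c \<le> w m"
  shows "continuous_embedding (orlicz_l k \<Psi> w) (orlicz_norm k \<Psi> w)
           (orlicz_l 0 \<Phi> w) (orlicz_norm 0 \<Phi> w) \<and>
         continuous_embedding (orlicz_s k \<Psi> w) (orlicz_norm k \<Psi> w)
           (orlicz_s 0 \<Phi> w) (orlicz_norm 0 \<Phi> w)"
proof -
  have one_le: "1 \<le> (1 + \<Psi> (real_of_int \<bar>m\<bar>)) powr k" for m
    using k orlicz_nonneg[OF \<Psi>] by (intro ge_one_powr_ge_zero) auto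
  \<comment> \<open>One term of the modular is at most \<open>M\<close>, while its weight is at
    least \<open>c\<close> and its power factor at least 1. Hence \<open>\<Psi>\<close> at the
    quotient is at most \<open>M / c\<close>, below \<open>\<Psi> T\<close>, and monotonicity gives
    the claim.\<close>
  have bound: "cmod (p m) / \<rho> < T"
    if \<rho>: "\<rho> > 0" and M: "orlicz_modular k \<Psi> w \<rho> p \<le> ennreal M" "M \<ge> 0"
      and T: "T > 0" "M / c < \<Psi> T" for p \<rho> M T m
  proof -
    let ?v = "(1 + \<Psi> (real_of_int \<bar>m\<bar>)) powr k"
    have nonneg: "\<Psi> (cmod (p m) / \<rho>) \<ge> 0" using \<rho> by (intro orlicz_nonneg[OF \<Psi>]) auto
    have "c * 1 * \<Psi> (cmod (p m) / \<rho>) \<le> w m * ?v * \<Psi> (cmod (p m) / \<rho>)"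
      using c one_le[of m] w[of m] nonneg by (intro mult_mono mult_right_mono) auto
    also have "\<dots> \<le> M"
      using order_trans[OF orlicz_modular_term_le M(1)] M(2) by (simp add: ennreal_le_iff)
    finally have "\<Psi> (cmod (p m) / \<rho>) \<le> M / c" using c by (simp add: field_simps)
    with T show ?thesis using orlicz_less_imp_less[OF \<Psi>, of T] by simp
  qed
  have mod: "orlicz_modular 0 \<Phi> w \<rho> p \<le> ennreal K * orlicz_modular k \<Psi> w \<sigma> p"
    if \<rho>\<sigma>: "\<rho> > 0" "\<sigma> > 0" and K: "K \<ge> 0"
      and le': "\<And>m. \<Phi> (cmod (p m) / \<rho>) \<le> K * \<Psi> (cmod (p m) / \<sigma>)" for p \<rho> \<sigma> K
  proof (rule orlicz_modular_mono[OF K w])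
    fix m
    let ?v = "(1 + \<Psi> (real_of_int \<bar>m\<bar>)) powr k" and ?y = "\<Psi> (cmod (p m) / \<sigma>)"
    \<comment> \<open>Positivity of the base matters: \<open>x powr 0\<close> is 1 for nonzero
      \<open>x\<close>, but \<open>0 powr 0 = 0\<close>.\<close>
    have "1 + \<Phi> (real_of_int \<bar>m\<bar>) > 0"
      using orlicz_nonneg[OF \<Phi>, of "real_of_int \<bar>m\<bar>"] by simp
    then have "(1 + \<Phi> (real_of_int \<bar>m\<bar>)) powr 0 * \<Phi> (cmod (p m) / \<rho>) \<le> K * (1 * ?y)"
      using le' by simp
    also have "\<dots> \<le> K * (?v * ?y)"
      using K one_le[of m] \<rho>\<sigma> orlicz_nonneg[OF \<Psi>] by (intro mult_left_mono mult_right_mono) auto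
    finally show "(1 + \<Phi> (real_of_int \<bar>m\<bar>)) powr 0 * \<Phi> (cmod (p m) / \<rho>) \<le> K * (?v * ?y)" .
  qed
  obtain T where T: "T > 0" "1 / c < \<Psi> T" using orlicz_ex_gt[OF \<Psi>] by blast
  \<comment> \<open>From \<open>T / t\<^sub>0 \<le> C\<close>, quotients below \<open>T\<close> land
    in \<open>[0, t\<^sub>0]\<close> after division by \<open>C\<close>; from
    \<open>\<gamma> \<le> C\<close>, the argument \<open>\<gamma> / C * x\<close> of
    \<open>\<Psi>\<close> is at most \<open>x\<close>. Here \<open>T\<close> belongs to the modular
    bound 1, so \<open>C\<close> does not depend on \<open>p\<close>.\<close>
  define C where "C = max \<gamma> (T / t\<^sub>0)"
  have C: "C > 0" "\<gamma> \<le> C" "T / t\<^sub>0 \<le> C" using \<gamma> by (auto simp: C_def)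
  show ?thesis
  proof (rule orlicz_embeddings[OF C(1)])
    fix p \<rho> assume \<rho>: "\<rho> > 0" and m1: "orlicz_modular k \<Psi> w \<rho> p \<le> 1"
    have "orlicz_modular 0 \<Phi> w (C * \<rho>) p \<le> ennreal 1 * orlicz_modular k \<Psi> w \<rho> p"
    proof (rule mod)
      fix m
      define x where "x = cmod (p m) / \<rho>"
      have x: "0 \<le> x" "x < T"
        using bound[OF \<rho> _ _ T, of p m] m1 \<rho> by (auto simp: x_def)
      have "x / C \<le> t\<^sub>0" using x C t\<^sub>0 by (simp add: field_simps)
      then have "\<Phi> (x / C) \<le> \<Psi> (\<gamma> * (x / C))" using x C by (intro bspec[OF le]) auto
      also have "\<gamma> * (x / C) = \<gamma> / C * x" by simp
      also have "\<Psi> \<dots> \<le> \<Psi> x"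
        using x C \<gamma> by (intro orlicz_mono[OF \<Psi>] mult_left_le_one_le) auto
      finally show "\<Phi> (cmod (p m) / (C * \<rho>)) \<le> 1 * \<Psi> (cmod (p m) / \<rho>)"
        by (simp add: x_def mult.commute)
    qed (use C \<rho> in auto)
    also have "\<dots> \<le> 1" using m1 by simp
    finally show "orlicz_modular 0 \<Phi> w (C * \<rho>) p \<le> 1" .
  next
    show "orlicz_s k \<Psi> w \<subseteq> orlicz_s 0 \<Phi> w"
      unfolding orlicz_s_def
    proof clarify
      fix p and \<rho> :: real
      assume p: "\<forall>\<rho>>0. orlicz_modular k \<Psi> w \<rho> p < top" and \<rho>: "\<rho> > 0"
      \<comment> \<open>With this scale \<open>\<gamma> * (cmod (p m) / \<rho>)\<close> is exactly
        \<open>cmod (p m) / \<sigma>\<close>. The modular of \<open>p\<close> is finite at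
        \<open>\<sigma>\<close> because it is finite at every scale.\<close>
      define \<sigma> where "\<sigma> = \<rho> / \<gamma>"
      have \<sigma>: "\<sigma> > 0" using \<rho> \<gamma> by (simp add: \<sigma>_def)
      have fin: "orlicz_modular k \<Psi> w \<sigma> p < top" using p \<sigma> by blast
      then obtain M where M: "M \<ge> 0" "orlicz_modular k \<Psi> w \<sigma> p = ennreal M"
        by (cases "orlicz_modular k \<Psi> w \<sigma> p") auto
      \<comment> \<open>Now \<open>T\<close> and \<open>K\<close> depend on \<open>p\<close> and
        \<open>\<rho>\<close> through \<open>M\<close>. This is harmless, since only finiteness of
        the target modular is claimed.\<close>
      obtain T where T: "T > 0" "M / c < \<Psi> T" using orlicz_ex_gt[OF \<Psi>] by blast
      obtain K where K: "K \<ge> 1" "\<And>t. t \<in> {0..T / \<gamma>} \<Longrightarrow> \<Phi> t \<le> K * \<Psi> (\<gamma> * t)"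
        using orlicz_comparison_extend[OF \<Phi> \<Psi> \<gamma> t\<^sub>0 le] by blast
      have "orlicz_modular 0 \<Phi> w \<rho> p \<le> ennreal K * orlicz_modular k \<Psi> w \<sigma> p"
      proof (rule mod[OF \<rho> \<sigma>])
        fix m
        have "cmod (p m) / \<sigma> < T" using bound[OF \<sigma> _ M(1) T] M(2) by simp
        then have "cmod (p m) / \<rho> \<le> T / \<gamma>" using \<gamma> \<rho> by (simp add: \<sigma>_def field_simps)
        then show "\<Phi> (cmod (p m) / \<rho>) \<le> K * \<Psi> (cmod (p m) / \<sigma>)"
          using K(2)[of "cmod (p m) / \<rho>"] \<rho> by (simp add: \<sigma>_def mult.commute)
      qed (use K in simp)
      also have "\<dots> < top" using fin by (simp add: ennreal_mult_less_top)
      finally show "orlicz_modular 0 \<Phi> w \<rho> p < top" .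
    qed
  qed
qed

theorem theorem3:
  fixes \<Phi> \<Psi> :: "real \<Rightarrow> real" and w :: "int \<Rightarrow> real"
  assumes "orlicz \<Phi>" and "orlicz \<Psi>" and "\<And>m. w m > 0"
  shows "((\<exists>\<gamma>\<in>{0<..1}. \<forall>t\<ge>0. \<Phi> t \<le> \<Psi> (\<gamma> * t)) \<longrightarrow>
          (\<forall>k k'. k' \<ge> k \<and> k \<ge> 0 \<longrightarrow>
             continuous_embedding (orlicz_l k' \<Psi> w) (orlicz_norm k' \<Psi> w)
                                  (orlicz_l k \<Phi> w) (orlicz_norm k \<Phi> w) \<and>
             continuous_embedding (orlicz_s k' \<Psi> w) (orlicz_norm k' \<Psi> w)
                                  (orlicz_s k \<Phi> w) (orlicz_norm k \<Phi> w)))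
       \<and> ((\<exists>\<gamma>>0. \<exists>t\<^sub>0>0. \<forall>t\<in>{0..t\<^sub>0}. \<Phi> t \<le> \<Psi> (\<gamma> * t)) \<longrightarrow>
          (\<forall>k\<ge>0. (INF m. w m) > 0 \<longrightarrow>
             continuous_embedding (orlicz_l k \<Psi> w) (orlicz_norm k \<Psi> w)
                                  (orlicz_l 0 \<Phi> w) (orlicz_norm 0 \<Phi> w) \<and>
             continuous_embedding (orlicz_s k \<Psi> w) (orlicz_norm k \<Psi> w)
                                  (orlicz_s 0 \<Phi> w) (orlicz_norm 0 \<Phi> w)))"
proof (rule conjI; clarify)
  fix \<gamma> k k' :: real
  assume "\<gamma> \<in> {0<..1}" "\<forall>t\<ge>0. \<Phi> t \<le> \<Psi> (\<gamma> * t)" "k \<le> k'" "0 \<le> k"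
  then show "continuous_embedding (orlicz_l k' \<Psi> w) (orlicz_norm k' \<Psi> w)
               (orlicz_l k \<Phi> w) (orlicz_norm k \<Phi> w) \<and>
             continuous_embedding (orlicz_s k' \<Psi> w) (orlicz_norm k' \<Psi> w)
               (orlicz_s k \<Phi> w) (orlicz_norm k \<Phi> w)"
    by (intro orlicz_embedding_global[OF assms]) auto
next
  fix \<gamma> t\<^sub>0 k :: real
  assume "0 < \<gamma>" "0 < t\<^sub>0" "\<forall>t\<in>{0..t\<^sub>0}. \<Phi> t \<le> \<Psi> (\<gamma> * t)" "0 \<le> k" and "0 < (INF m. w m)"
  \<comment> \<open>The infimum is taken in the reals, where it is a lower bound only for a family
    bounded below; positivity of the weights supplies the bound 0.\<close>
  moreover have "(INF m. w m) \<le> w m" for m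
    using assms(3) by (intro cINF_lower bdd_belowI2[of _ 0]) (auto intro: less_imp_le)
  ultimately show "continuous_embedding (orlicz_l k \<Psi> w) (orlicz_norm k \<Psi> w)
               (orlicz_l 0 \<Phi> w) (orlicz_norm 0 \<Phi> w) \<and>
             continuous_embedding (orlicz_s k \<Psi> w) (orlicz_norm k \<Psi> w)
               (orlicz_s 0 \<Phi> w) (orlicz_norm 0 \<Phi> w)"
    by (rule orlicz_embedding_local[OF assms])
qed

end
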